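(* Let $\mu$ be a bounded, monotone, submodular and strictly positive set function on $\mathcal{B}_{[0,1]}$ and $\delta$ a bounded, strictly positive Borel measure on $\mathcal{B}_{[0,1]}$, such that $\mu(A)\le\delta(A)$ for all $A\in\mathcal{B}_{[0,1]}$. Then $L^{1}_{\delta,+}\subset L^{1}_{\mu,+}$ and, defining the Bernstein-Durrmeyer-Choquet operators $$\overline{D}_{n,\delta,\mu}(f)(x)=\sum_{k=0}^{n-1}p_{n,k}(x)\cdot\frac{\int_{0}^{1}f(t)p_{n,k}(t)\,d\delta(t)}{\int_{0}^{1}p_{n,k}(t)\,d\delta(t)}+x^{n}\cdot\frac{(C)\int_{0}^{1}f(t)t^{n}\,d\mu(t)}{(C)\int_{0}^{1}t^{n}\,d\mu(t)},$$ for all $f\in L^{1}_{\delta,+}$ and $n\in\mathbb{N}$, and denoting $\varphi_{x}(t)=|t-x|$, we have $$\|f-\overline{D}_{n,\delta,\mu}(f)\|_{L^{1}_{\mu}}\le 2\,\overline{K}\left(f;\frac{\|\overline{D}_{n,\delta,\mu}(\varphi_{x})\|_{L^{1}_{\mu}}}{2}\right)_{L^{1}_{\mu,\delta}}.$$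
   Context: $\mathcal{B}_{[0,1]}$ is the Borel $\sigma$-algebra of $[0,1]$ and $p_{n,k}(x)=\binom{n}{k}x^{k}(1-x)^{n-k}$. A set function $\mu:\mathcal{B}_{[0,1]}\to[0,+\infty]$ is monotone if $\mu(\emptyset)=0$ and $\mu(A)\le\mu(B)$ whenever $A\subset B$; submodular if $\mu(A\cup B)+\mu(A\cap B)\le\mu(A)+\mu(B)$ for all $A,B$; bounded if $\mu([0,1])<+\infty$; strictly positive if $\mu(A\cap[0,1])>0$ for every open $A\subset\mathbb{R}$ with $A\cap[0,1]\neq\emptyset$. For a monotone set function $\mu$ and a nonnegative Borel measurable $f$ on $[0,1]$, the Choquet integral is $(C)\int_{0}^{1}f\,d\mu=\int_{0}^{+\infty}\mu(\{t\in[0,1]:f(t)\ge\beta\})\,d\beta$. For a Borel measure it coincides with the Lebesgue integral. $L^{1}_{\mu}$ is the set of $\mathcal{B}_{[0,1]}$-measurable $f:[0,1]\to\mathbb{R}$ with $\|f\|_{L^{1}_{\mu}}=(C)\int_{0}^{1}|f(t)|\,d\mu(t)<+\infty$, and $L^{1}_{\mu,+}$ is the set of those $f\in L^{1}_{\mu}$ with values in $\mathbb{R}_{+}=[0,+\infty)$; similarly $L^{1}_{\delta}$, $L^{1}_{\delta,+}$ for $\delta$. $C^{1}_{+}([0,1])$ is the set of nonnegative continuously differentiable functions on $[0,1]$, $\|\cdot\|_{C([0,1])}$ is the sup norm, and for $t\ge 0$ $$\overline{K}(f;t)_{L^{1}_{\mu,\delta}}=\inf_{g\in C^{1}_{+}([0,1])}\{\|f-g\|_{L^{1}_{\mu}}+\|f-g\|_{L^{1}_{\delta}}+t\,\|g'\|_{C([0,1])}\}.$$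 The quantity $\|\overline{D}_{n,\delta,\mu}(\varphi_{x})\|_{L^{1}_{\mu}}$ means the $L^{1}_{\mu}$-"norm" of the function $x\mapsto\overline{D}_{n,\delta,\mu}(\varphi_{x})(x)$. *)

theory Defs
  imports "HOL-Analysis.Analysis"
begin

(* Functions on [0,1] are total functions on the reals of which only the values on {0..1} matter,
   and set functions on the Borel sets of [0,1] are total functions on "real set" of which only
   the values on sets unit_borel matter. *)

abbreviation unit_borel :: "real measure" where
  "unit_borel \<equiv> restrict_space borel {0..1}"

definition monotone_set_fun :: "(real set \<Rightarrow> ennreal) \<Rightarrow> bool" where
  "monotone_set_fun \<mu> \<longleftrightarrow> \<mu> {} = 0 \<and>
     (\<forall>A\<in>sets unit_borel. \<forall>B\<in>sets unit_borel. A \<subseteq> B \<longrightarrow> \<mu> A \<le> \<mu> B)"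

definition submodular_set_fun :: "(real set \<Rightarrow> ennreal) \<Rightarrow> bool" where
  "submodular_set_fun \<mu> \<longleftrightarrow>
     (\<forall>A\<in>sets unit_borel. \<forall>B\<in>sets unit_borel. \<mu> (A \<union> B) + \<mu> (A \<inter> B) \<le> \<mu> A + \<mu> B)"

definition bounded_set_fun :: "(real set \<Rightarrow> ennreal) \<Rightarrow> bool" where
  "bounded_set_fun \<mu> \<longleftrightarrow> \<mu> {0..1} < \<infinity>"

definition strictly_positive_set_fun :: "(real set \<Rightarrow> ennreal) \<Rightarrow> bool" where
  "strictly_positive_set_fun \<mu> \<longleftrightarrow>
     (\<forall>A. open A \<and> A \<inter> {0..1} \<noteq> {} \<longrightarrow> \<mu> (A \<inter> {0..1}) > 0)"

definition choquet_integral :: "(real set \<Rightarrow> ennreal) \<Rightarrow> (real \<Rightarrow> real) \<Rightarrow> ennreal" where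
  "choquet_integral \<mu> f = (\<integral>\<^sup>+\<beta>\<in>{0..}. \<mu> {t \<in> {0..1}. f t \<ge> \<beta>} \<partial>lborel)"

definition L1_norm :: "(real set \<Rightarrow> ennreal) \<Rightarrow> (real \<Rightarrow> real) \<Rightarrow> ennreal" where
  "L1_norm \<mu> f = choquet_integral \<mu> (\<lambda>t. \<bar>f t\<bar>)"

definition L1_space :: "(real set \<Rightarrow> ennreal) \<Rightarrow> (real \<Rightarrow> real) set" where
  "L1_space \<mu> = {f. f \<in> borel_measurable unit_borel \<and> L1_norm \<mu> f < \<infinity>}"

definition L1_plus :: "(real set \<Rightarrow> ennreal) \<Rightarrow> (real \<Rightarrow> real) set" where
  "L1_plus \<mu> = {f \<in> L1_space \<mu>. \<forall>t\<in>{0..1}. 0 \<le> f t}"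

(* The derivative on [0,1], one-sided at the two endpoints. *)
definition unit_deriv :: "(real \<Rightarrow> real) \<Rightarrow> real \<Rightarrow> real" where
  "unit_deriv g x = vector_derivative g (at x within {0..1})"

definition C1_plus :: "(real \<Rightarrow> real) set" where
  "C1_plus = {g. g differentiable_on {0..1} \<and> continuous_on {0..1} (unit_deriv g) \<and>
                 (\<forall>x\<in>{0..1}. 0 \<le> g x)}"

definition sup_norm :: "(real \<Rightarrow> real) \<Rightarrow> ennreal" where
  "sup_norm h = (SUP x\<in>{0..1}. ennreal \<bar>h x\<bar>)"

definition K_functional ::
  "(real set \<Rightarrow> ennreal) \<Rightarrow> real measure \<Rightarrow> (real \<Rightarrow> real) \<Rightarrow> ennreal \<Rightarrow> ennreal" where
  "K_functional \<mu> \<delta> f t =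
     (INF g\<in>C1_plus. L1_norm \<mu> (\<lambda>x. f x - g x) + L1_norm (emeasure \<delta>) (\<lambda>x. f x - g x)
                      + t * sup_norm (unit_deriv g))"

(* Bernstein n k is the library's p_{n,k}. For f in L1_plus (emeasure \<delta>), \<mu> bounded and
   \<mu> \<le> \<delta>, the two Choquet integrals are finite, so enn2real only changes their type. *)
definition BDC_operator ::
  "(real set \<Rightarrow> ennreal) \<Rightarrow> real measure \<Rightarrow> nat \<Rightarrow> (real \<Rightarrow> real) \<Rightarrow> real \<Rightarrow> real" where
  "BDC_operator \<mu> \<delta> n f x =
     (\<Sum>k<n. Bernstein n k x *
        ((LINT t|\<delta>. f t * Bernstein n k t) / (LINT t|\<delta>. Bernstein n k t)))
     + x ^ n * (enn2real (choquet_integral \<mu> (\<lambda>t. f t * t ^ n))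
                / enn2real (choquet_integral \<mu> (\<lambda>t. t ^ n)))"

end

theory Submission
  imports Defs
begin

text \<open>The Choquet integral of a submodular set function is subadditive, and this one property gives the
Choquet integral enough in common with the Lebesgue integral to run the classical Bernstein-Durrmeyer
estimate.

Let $D$ be the operator. Each of its coefficients is a weighted mean
$(C)\int f p_{n,k}\,d\nu / (C)\int p_{n,k}\,d\nu$ with $\nu = \delta$ for $k < n$ and $\nu = \mu$ for
$k = n$: for a measure the Choquet integral is the Lebesgue integral (\<open>choquet_measure\<close>), and a measure
is itself submodular. Such a mean is monotone, subadditive, positively homogeneous and fixes nonnegative constants
(\<open>mean_le\<close>, \<open>mean_const\<close>), so $D$ has the same properties.

For $g \in C^1_+$ with $M = \|g'\|$ this turns $|g(t) - g(x)| \le M |t - x|$ into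
$|g(x) - D g(x)| \le M D(\varphi_x)(x)$ (\<open>BDC_smooth_error\<close>), and it gives $|D f - D g| \le D |f - g|$.
Furthermore $\|D h\|_{L^1_\mu} \le \|h\|_{L^1_\mu} + \|h\|_{L^1_\delta}$ (\<open>BDC_norm_le\<close>). Integrating
$$|f - D f| \le |f - g| + M D(\varphi_x) + D |f - g|$$
with respect to $\mu$ therefore yields at most twice the expression inside the infimum that defines the
K-functional (\<open>BDC_error_le\<close>).

A monotone set function need not be continuous along increasing sequences of sets, so subadditivity
cannot be carried over from simple functions by monotone convergence. Instead, the Choquet integrals are
compared with sums of values of $\nu$ on the superlevel sets at integer levels. For integer valued
functions subadditivity is a telescoping sum of submodularity inequalities
(\<open>layers_add_indicator\<close>), and for real functions this gives it up to an error $2 \nu([0,1])$. Replacing $f$ and $g$ by $f/c$ and $g/c$ and letting $c \to 0$ removes the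
error, because the integral is homogeneous.\<close>

section \<open>Set functions and superlevel sets\<close>

text \<open>The codomain is generic because superlevel sets are also taken of the integer parts of real functions.\<close>
definition superlevel :: "(real \<Rightarrow> 'a::ord) \<Rightarrow> 'a \<Rightarrow> real set" where
  "superlevel f \<beta> = {t \<in> {0..1}. \<beta> \<le> f t}"

lemma mem_superlevel [simp]: "t \<in> superlevel f \<beta> \<longleftrightarrow> 0 \<le> t \<and> t \<le> 1 \<and> \<beta> \<le> f t"
  by (auto simp: superlevel_def)

lemma choquet_eq_superlevel:
  "choquet_integral \<nu> f = (\<integral>\<^sup>+\<beta>\<in>{0..}. \<nu> (superlevel f \<beta>) \<partial>lborel)"
  by (simp add: choquet_integral_def superlevel_def)

lemma superlevel_in_unit_borel:
  fixes f :: "real \<Rightarrow> real"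
  assumes "f \<in> borel_measurable unit_borel"
  shows "superlevel f \<beta> \<in> sets unit_borel"
proof -
  have "{t \<in> space unit_borel. \<beta> \<le> f t} \<in> sets unit_borel"
    using assms by measurable
  then show ?thesis by (simp add: space_restrict_space superlevel_def)
qed

lemma choquet_cong:
  assumes "\<And>t. t \<in> {0..1} \<Longrightarrow> f t = g t"
  shows "choquet_integral \<nu> f = choquet_integral \<nu> g"
proof -
  have "superlevel f \<beta> = superlevel g \<beta>" for \<beta>
    using assms by auto
  then show ?thesis unfolding choquet_eq_superlevel by presburger
qed

lemma choquet_set_fun_mono:
  assumes "\<And>A. A \<in> sets unit_borel \<Longrightarrow> \<mu> A \<le> \<nu> A" and "f \<in> borel_measurable unit_borel"
  shows "choquet_integral \<mu> f \<le> choquet_integral \<nu> f"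
  unfolding choquet_eq_superlevel
  by (intro nn_integral_mono mult_right_mono assms(1) superlevel_in_unit_borel assms(2)) simp

locale unit_capacity =
  fixes \<nu> :: "real set \<Rightarrow> ennreal"
  assumes monotone: "monotone_set_fun \<nu>"
    and submodular: "submodular_set_fun \<nu>"
    and bounded: "bounded_set_fun \<nu>"
begin

lemma empty [simp]: "\<nu> {} = 0"
  using monotone by (simp add: monotone_set_fun_def)

lemma mono:
  assumes "A \<in> sets unit_borel" "B \<in> sets unit_borel" "A \<subseteq> B"
  shows "\<nu> A \<le> \<nu> B"
  using monotone assms by (simp add: monotone_set_fun_def)

lemma le_total: "A \<in> sets unit_borel \<Longrightarrow> \<nu> A \<le> \<nu> {0..1}"
  by (rule mono) (use sets.sets_into_space[of A unit_borel] in
      \<open>auto simp: space_restrict_space sets_restrict_space_iff\<close>)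

lemma total_finite: "\<nu> {0..1} < \<infinity>"
  using bounded by (simp add: bounded_set_fun_def)

lemma union_inter_le:
  assumes "A \<in> sets unit_borel" "B \<in> sets unit_borel"
  shows "\<nu> (A \<union> B) + \<nu> (A \<inter> B) \<le> \<nu> A + \<nu> B"
  using submodular assms by (simp add: submodular_set_fun_def)

lemma choquet_mono:
  assumes "f \<in> borel_measurable unit_borel" "g \<in> borel_measurable unit_borel"
    and "\<And>t. t \<in> {0..1} \<Longrightarrow> f t \<le> g t"
  shows "choquet_integral \<nu> f \<le> choquet_integral \<nu> g"
  unfolding choquet_eq_superlevel
proof (intro nn_integral_mono mult_right_mono)
  fix \<beta> :: real
  have "superlevel f \<beta> \<subseteq> superlevel g \<beta>"
    using order_trans[OF _ assms(3)] by (simp add: subset_iff)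
  then show "\<nu> (superlevel f \<beta>) \<le> \<nu> (superlevel g \<beta>)"
    by (intro mono superlevel_in_unit_borel assms)
qed simp

text \<open>As a function of the level, $\nu$ of the superlevel set is antitone and finite, hence Borel.\<close>
lemma superlevel_borel_measurable:
  fixes f :: "real \<Rightarrow> real"
  assumes "f \<in> borel_measurable unit_borel"
  shows "(\<lambda>\<beta>. \<nu> (superlevel f \<beta>)) \<in> borel_measurable borel"
proof -
  have fin: "\<nu> (superlevel f \<beta>) < \<infinity>" for \<beta>
    using le_total[OF superlevel_in_unit_borel[OF assms, of \<beta>]] total_finite by order
  have "mono (\<lambda>\<beta>. enn2real (\<nu> (superlevel f (- \<beta>))))"
    by (intro monoI enn2real_mono mono superlevel_in_unit_borel assms) (use fin in auto)
  then have "(\<lambda>\<beta>. enn2real (\<nu> (superlevel f (- \<beta>)))) \<in> borel_measurable borel"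
    by (intro borel_measurable_mono) auto
  then have "(\<lambda>\<beta>. (\<lambda>\<beta>. enn2real (\<nu> (superlevel f (- \<beta>)))) (- \<beta>)) \<in> borel_measurable borel"
    by measurable
  then have "(\<lambda>\<beta>. ennreal ((\<lambda>\<beta>. enn2real (\<nu> (superlevel f (- \<beta>)))) (- \<beta>))) \<in> borel_measurable borel"
    by (rule measurable_compose[OF _ measurable_ennreal])
  moreover have "(\<lambda>\<beta>. ennreal ((\<lambda>\<beta>. enn2real (\<nu> (superlevel f (- \<beta>)))) (- \<beta>))) = (\<lambda>\<beta>. \<nu> (superlevel f \<beta>))"
    using fin by (intro ext) simp
  ultimately show ?thesis by (simp only:)
qed

section \<open>Subadditivity of the Choquet integral\<close>

lemma choquet_cmult:
  assumes [measurable]: "f \<in> borel_measurable unit_borel" and "0 \<le> c"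
  shows "choquet_integral \<nu> (\<lambda>t. c * f t) = ennreal c * choquet_integral \<nu> f"
proof (cases "c = 0")
  case True
  have "choquet_integral \<nu> (\<lambda>t. 0) = (\<integral>\<^sup>+\<beta>\<in>{0::real}. \<nu> {0..1} \<partial>lborel)"
    unfolding choquet_eq_superlevel
  proof (intro nn_integral_cong)
    fix \<beta> :: real
    have "superlevel (\<lambda>t. 0) \<beta> = (if \<beta> \<le> 0 then {0..1} else {})"
      by auto
    then show "\<nu> (superlevel (\<lambda>t. 0) \<beta>) * indicator {0..} \<beta> = \<nu> {0..1} * indicator {0} \<beta>"
      by (simp add: indicator_def)
  qed
  also have "\<dots> = 0"
    by simp
  finally show ?thesis using True by simp
next
  case False
  with \<open>0 \<le> c\<close> have c: "c > 0" by simp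
  have "choquet_integral \<nu> (\<lambda>t. c * f t)
      = ennreal \<bar>c\<bar> * (\<integral>\<^sup>+\<beta>. \<nu> (superlevel (\<lambda>t. c * f t) (0 + c * \<beta>)) * indicator {0..} (0 + c * \<beta>) \<partial>lborel)"
    unfolding choquet_eq_superlevel using c
    by (intro nn_integral_real_affine borel_measurable_times_ennreal
        superlevel_borel_measurable borel_measurable_indicator) auto
  also have "\<dots> = ennreal c * choquet_integral \<nu> f"
    unfolding choquet_eq_superlevel using c
    by (auto simp: indicator_def zero_le_mult_iff superlevel_def intro!: arg_cong[where f = "(*) _"] nn_integral_cong)
  finally show ?thesis .
qed

text \<open>The lower and upper Riemann sums, with mesh 1, of the antitone function whose integral is the Choquet
integral.\<close>
lemma unit_layers:
  assumes [measurable]: "f \<in> borel_measurable unit_borel"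
  shows layers_le_choquet: "(\<Sum>j. \<nu> (superlevel f (real (Suc j)))) \<le> choquet_integral \<nu> f"
    and choquet_le_layers: "choquet_integral \<nu> f \<le> (\<Sum>j. \<nu> (superlevel f (real j)))"
proof -
  let ?I = "\<lambda>j. {real j..<real (Suc j)}"
  have cover: "{0..} = (\<Union>j. ?I j)"
  proof (intro set_eqI iffI)
    fix x :: real assume "x \<in> {0..}"
    then have "x \<in> ?I (nat \<lfloor>x\<rfloor>)" by (auto; linarith)
    then show "x \<in> (\<Union>j. ?I j)" by blast
  qed auto
  have meas: "(\<lambda>\<beta>. \<nu> (superlevel f \<beta>)) \<in> borel_measurable lborel"
    using superlevel_borel_measurable[OF assms] by simp
  have disj: "disjoint_family ?I"
    by (auto simp: disjoint_family_on_def)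
  have ch: "choquet_integral \<nu> f = (\<Sum>j. \<integral>\<^sup>+\<beta>\<in>?I j. \<nu> (superlevel f \<beta>) \<partial>lborel)"
    unfolding choquet_eq_superlevel cover
    by (intro nn_integral_disjoint_family disj meas) simp
  have const: "c = (\<integral>\<^sup>+\<beta>\<in>?I j. c \<partial>lborel)" for j c
    by (simp add: nn_integral_cmult_indicator)
  have lower: "\<nu> (superlevel f (real (Suc j))) \<le> (\<integral>\<^sup>+\<beta>\<in>?I j. \<nu> (superlevel f \<beta>) \<partial>lborel)" for j
    by (subst (1) const[where j = j], intro nn_integral_mono)
      (auto simp: indicator_def intro!: mono superlevel_in_unit_borel)
  have upper: "(\<integral>\<^sup>+\<beta>\<in>?I j. \<nu> (superlevel f \<beta>) \<partial>lborel) \<le> \<nu> (superlevel f (real j))" for j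
    by (subst (2) const[where j = j], intro nn_integral_mono)
      (auto simp: indicator_def intro!: mono superlevel_in_unit_borel)
  show "(\<Sum>j. \<nu> (superlevel f (real (Suc j)))) \<le> choquet_integral \<nu> f"
    unfolding ch by (intro suminf_le lower) auto
  show "choquet_integral \<nu> f \<le> (\<Sum>j. \<nu> (superlevel f (real j)))"
    unfolding ch by (intro suminf_le upper) auto
qed

text \<open>Submodularity for the pair $\{h \ge j+1\}$ and $A \cap \{h \ge j\}$, whose union is
$\{h + 1_A \ge j+1\}$ and whose intersection is $A \cap \{h \ge j+1\}$, telescopes over $j$. The term
$\nu(A \cap \{h \ge m\})$ on the left is what remains of the telescoping sum; stated with it, the
induction needs no subtraction.\<close>
lemma layers_add_indicator:
  fixes h :: "real \<Rightarrow> nat"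
  assumes h: "\<And>j. superlevel h j \<in> sets unit_borel" and A: "A \<in> sets unit_borel"
  shows "(\<Sum>j<m. \<nu> (superlevel (\<lambda>t. h t + of_bool (t \<in> A)) (Suc j))) + \<nu> (A \<inter> superlevel h m)
    \<le> (\<Sum>j<m. \<nu> (superlevel h (Suc j))) + \<nu> A"
proof (induction m)
  case 0
  have "\<nu> (A \<inter> superlevel h 0) \<le> \<nu> A"
    by (intro mono A sets.Int h) auto
  then show ?case by simp
next
  case (Suc m)
  let ?h' = "\<lambda>t. h t + of_bool (t \<in> A)"
  have "A \<subseteq> {0..1}"
    using sets.sets_into_space[OF A] by (simp add: space_restrict_space)
  then have "superlevel h (Suc m) \<union> A \<inter> superlevel h m = superlevel ?h' (Suc m)"
    and "superlevel h (Suc m) \<inter> (A \<inter> superlevel h m) = A \<inter> superlevel h (Suc m)"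
    by (auto simp: of_bool_def split: if_splits)
  then have step: "\<nu> (superlevel ?h' (Suc m)) + \<nu> (A \<inter> superlevel h (Suc m))
      \<le> \<nu> (superlevel h (Suc m)) + \<nu> (A \<inter> superlevel h m)"
    using union_inter_le[OF h[of "Suc m"] sets.Int[OF A h[of m]]] by simp
  have "(\<Sum>j<Suc m. \<nu> (superlevel ?h' (Suc j))) + \<nu> (A \<inter> superlevel h (Suc m))
      = (\<Sum>j<m. \<nu> (superlevel ?h' (Suc j)))
        + (\<nu> (superlevel ?h' (Suc m)) + \<nu> (A \<inter> superlevel h (Suc m)))"
    by (simp only: sum.lessThan_Suc add.assoc)
  also have "\<dots> \<le> ((\<Sum>j<m. \<nu> (superlevel ?h' (Suc j))) + \<nu> (A \<inter> superlevel h m))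
        + \<nu> (superlevel h (Suc m))"
    using add_left_mono[OF step, of "\<Sum>j<m. \<nu> (superlevel ?h' (Suc j))"]
    by (simp only: ac_simps)
  also have "\<dots> \<le> ((\<Sum>j<m. \<nu> (superlevel h (Suc j))) + \<nu> A) + \<nu> (superlevel h (Suc m))"
    by (rule add_right_mono[OF Suc.IH])
  finally show ?case by (simp only: sum.lessThan_Suc ac_simps)
qed

text \<open>An integer valued $g$ is the sum of the indicators of its superlevel sets, which are added to $h$ one
at a time.\<close>
lemma layers_add:
  fixes h g :: "real \<Rightarrow> nat"
  assumes h[measurable]: "h \<in> measurable unit_borel (count_space UNIV)"
    and g[measurable]: "g \<in> measurable unit_borel (count_space UNIV)"
  shows "(\<Sum>j<m. \<nu> (superlevel (\<lambda>t. h t + g t) (Suc j)))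
    \<le> (\<Sum>j<m. \<nu> (superlevel h (Suc j))) + (\<Sum>j<m. \<nu> (superlevel g (Suc j)))"
proof -
  have lev: "superlevel k j \<in> sets unit_borel"
    if [measurable]: "k \<in> measurable unit_borel (count_space UNIV)" for k :: "real \<Rightarrow> nat" and j
  proof -
    have "{t \<in> space unit_borel. j \<le> k t} \<in> sets unit_borel" by measurable
    then show ?thesis by (simp add: space_restrict_space superlevel_def)
  qed
  have "(\<Sum>j<m. \<nu> (superlevel (\<lambda>t. h t + min N (g t)) (Suc j)))
    \<le> (\<Sum>j<m. \<nu> (superlevel h (Suc j))) + (\<Sum>j<N. \<nu> (superlevel g (Suc j)))" for N
  proof (induction N)
    case 0
    show ?case by simp
  next
    case (Suc N)
    let ?h = "\<lambda>t. h t + min N (g t)" and ?A = "superlevel g (Suc N)"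
    have "superlevel (\<lambda>t. h t + min (Suc N) (g t)) (Suc j)
        = superlevel (\<lambda>t. ?h t + of_bool (t \<in> ?A)) (Suc j)" for j
      by (auto simp: min_def of_bool_def split: if_splits)
    then have "(\<Sum>j<m. \<nu> (superlevel (\<lambda>t. h t + min (Suc N) (g t)) (Suc j)))
        \<le> (\<Sum>j<m. \<nu> (superlevel (\<lambda>t. ?h t + of_bool (t \<in> ?A)) (Suc j)))
          + \<nu> (?A \<inter> superlevel ?h m)"
      by simp
    also have "\<dots> \<le> (\<Sum>j<m. \<nu> (superlevel ?h (Suc j))) + \<nu> ?A"
      by (rule layers_add_indicator; rule lev; measurable)
    also have "\<dots> \<le> ((\<Sum>j<m. \<nu> (superlevel h (Suc j))) + (\<Sum>j<N. \<nu> (superlevel g (Suc j)))) + \<nu> ?A"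
      by (rule add_right_mono[OF Suc.IH])
    finally show ?case by (simp add: ac_simps)
  qed
  (* The superlevel sets at levels up to m do not see the values of g above m. *)
  moreover have "(\<Sum>j<m. \<nu> (superlevel (\<lambda>t. h t + g t) (Suc j)))
      = (\<Sum>j<m. \<nu> (superlevel (\<lambda>t. h t + min m (g t)) (Suc j)))"
    by (intro sum.cong refl arg_cong[where f = \<nu>]) auto
  ultimately show ?thesis by simp
qed

text \<open>The integer parts $F$, $G$ of $f$, $g$ satisfy $f + g < F + G + 2$, so passing from $f + g$ to the
integer valued $F + G$ shifts the upper Riemann sum by two layers, each at most $\nu([0,1])$.\<close>
lemma choquet_add_coarse:
  assumes [measurable]: "f \<in> borel_measurable unit_borel" "g \<in> borel_measurable unit_borel"
    and f0: "\<And>t. t \<in> {0..1} \<Longrightarrow> 0 \<le> f t" and g0: "\<And>t. t \<in> {0..1} \<Longrightarrow> 0 \<le> g t"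
  shows "choquet_integral \<nu> (\<lambda>t. f t + g t)
    \<le> choquet_integral \<nu> f + choquet_integral \<nu> g + 2 * \<nu> {0..1}"
proof -
  let ?F = "\<lambda>t. nat \<lfloor>f t\<rfloor>" and ?G = "\<lambda>t. nat \<lfloor>g t\<rfloor>" and ?s = "\<lambda>t. f t + g t"
  have F: "superlevel ?F (Suc j) = superlevel f (real (Suc j))" for j
    by (auto simp: Suc_le_eq zless_nat_eq_int_zless less_floor_iff add.commute)
  have G: "superlevel ?G (Suc j) = superlevel g (real (Suc j))" for j
    by (auto simp: Suc_le_eq zless_nat_eq_int_zless less_floor_iff add.commute)
  have shift: "superlevel ?s (real (j + 2)) \<subseteq> superlevel (\<lambda>t. ?F t + ?G t) (Suc j)" for j
  proof
    fix t assume t: "t \<in> superlevel ?s (real (j + 2))"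
    then have "f t < real (?F t) + 1" "g t < real (?G t) + 1"
      using f0[of t] g0[of t] by (auto; linarith)+
    then have "real (j + 2) < real (?F t + ?G t + 2)" using t by auto
    then show "t \<in> superlevel (\<lambda>t. ?F t + ?G t) (Suc j)" using t unfolding of_nat_less_iff by simp
  qed
  have FG: "superlevel (\<lambda>t. ?F t + ?G t) j \<in> sets unit_borel" for j
  proof -
    have "{t \<in> space unit_borel. j \<le> ?F t + ?G t} \<in> sets unit_borel" by measurable
    then show ?thesis by (simp add: space_restrict_space superlevel_def)
  qed
  have "(\<Sum>j<m. \<nu> (superlevel ?s (real j)))
      \<le> choquet_integral \<nu> f + choquet_integral \<nu> g + 2 * \<nu> {0..1}" for m
  proof -
    have "(\<Sum>j<m. \<nu> (superlevel ?s (real j))) \<le> (\<Sum>j<Suc (Suc m). \<nu> (superlevel ?s (real j)))"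
      by (intro sum_mono2) auto
    also have "\<dots> = \<nu> (superlevel ?s 0) + \<nu> (superlevel ?s 1)
        + (\<Sum>j<m. \<nu> (superlevel ?s (real (j + 2))))"
      unfolding sum.lessThan_Suc_shift by (simp add: add.assoc)
    also have "\<dots> \<le> \<nu> {0..1} + \<nu> {0..1}
        + (\<Sum>j<m. \<nu> (superlevel (\<lambda>t. ?F t + ?G t) (Suc j)))"
      by (intro add_mono sum_mono le_total mono shift superlevel_in_unit_borel FG) measurable
    also have "(\<Sum>j<m. \<nu> (superlevel (\<lambda>t. ?F t + ?G t) (Suc j)))
        \<le> (\<Sum>j<m. \<nu> (superlevel ?F (Suc j))) + (\<Sum>j<m. \<nu> (superlevel ?G (Suc j)))"
      by (rule layers_add) measurable
    also have "\<dots> \<le> (\<Sum>j. \<nu> (superlevel f (real (Suc j)))) + (\<Sum>j. \<nu> (superlevel g (real (Suc j))))"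
      unfolding F G by (intro add_mono sum_le_suminf) auto
    also have "\<dots> \<le> choquet_integral \<nu> f + choquet_integral \<nu> g"
      by (intro add_mono layers_le_choquet) auto
    finally show ?thesis by (simp add: mult_2 ac_simps add_left_mono)
  qed
  then have "(\<Sum>j. \<nu> (superlevel ?s (real j)))
      \<le> choquet_integral \<nu> f + choquet_integral \<nu> g + 2 * \<nu> {0..1}"
    by (intro suminf_le_const) auto
  moreover have "choquet_integral \<nu> ?s \<le> (\<Sum>j. \<nu> (superlevel ?s (real j)))"
    by (intro choquet_le_layers) measurable
  ultimately show ?thesis by (rule order_trans[rotated])
qed

text \<open>By homogeneity the coarse bound for $f/c$ and $g/c$ has the error $2 c\, \nu([0,1])$, which is
arbitrarily small.\<close>
lemma choquet_add:
  assumes [measurable]: "f \<in> borel_measurable unit_borel" "g \<in> borel_measurable unit_borel"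
    and f0: "\<And>t. t \<in> {0..1} \<Longrightarrow> 0 \<le> f t" and g0: "\<And>t. t \<in> {0..1} \<Longrightarrow> 0 \<le> g t"
  shows "choquet_integral \<nu> (\<lambda>t. f t + g t) \<le> choquet_integral \<nu> f + choquet_integral \<nu> g"
proof (rule ennreal_le_epsilon)
  fix e :: real assume e: "0 < e"
  obtain M where M: "\<nu> {0..1} = ennreal M" "0 \<le> M"
    using total_finite by (cases "\<nu> {0..1}") auto
  (* The summand 1 keeps the denominator positive. *)
  define c where "c = e / (2 * M + 1)"
  have c: "c > 0" "c * (2 * M) \<le> e"
    using e M(2) by (simp_all add: c_def field_simps)
  have scale: "ennreal c * choquet_integral \<nu> (\<lambda>t. h t / c) = choquet_integral \<nu> h"
    if [measurable]: "h \<in> borel_measurable unit_borel" for h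
    using choquet_cmult[of "\<lambda>t. h t / c" c] c by simp
  have "choquet_integral \<nu> (\<lambda>t. f t + g t) = ennreal c * choquet_integral \<nu> (\<lambda>t. f t / c + g t / c)"
    using scale[of "\<lambda>t. f t + g t"] by (simp add: add_divide_distrib)
  also have "\<dots> \<le> ennreal c * (choquet_integral \<nu> (\<lambda>t. f t / c) + choquet_integral \<nu> (\<lambda>t. g t / c)
      + 2 * \<nu> {0..1})"
    using c f0 g0 by (intro mult_left_mono choquet_add_coarse) auto
  also have "\<dots> = choquet_integral \<nu> f + choquet_integral \<nu> g + ennreal c * (2 * \<nu> {0..1})"
    by (simp add: distrib_left scale)
  also have "ennreal c * (2 * \<nu> {0..1}) = ennreal (c * (2 * M))"
    unfolding M(1) using c M(2) by (simp add: ennreal_mult ennreal_numeral[symmetric] del: ennreal_numeral)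
  also have "\<dots> \<le> ennreal e"
    using c by (intro ennreal_leI)
  finally show "choquet_integral \<nu> (\<lambda>t. f t + g t)
      \<le> choquet_integral \<nu> f + choquet_integral \<nu> g + ennreal e"
    by (simp add: add_left_mono)
qed

lemma choquet_sum:
  assumes "finite I" and "\<And>i. i \<in> I \<Longrightarrow> f i \<in> borel_measurable unit_borel"
    and "\<And>i t. i \<in> I \<Longrightarrow> t \<in> {0..1} \<Longrightarrow> 0 \<le> f i t"
  shows "choquet_integral \<nu> (\<lambda>t. \<Sum>i\<in>I. f i t) \<le> (\<Sum>i\<in>I. choquet_integral \<nu> (f i))"
  using assms
proof (induction I rule: finite_induct)
  case empty
  show ?case using choquet_cmult[of "\<lambda>t. 0" 0] by simp
next
  case (insert i I)
  have "choquet_integral \<nu> (\<lambda>t. \<Sum>i\<in>insert i I. f i t)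
      = choquet_integral \<nu> (\<lambda>t. f i t + (\<Sum>i\<in>I. f i t))"
    using insert.hyps by simp
  also have "\<dots> \<le> choquet_integral \<nu> (f i) + choquet_integral \<nu> (\<lambda>t. \<Sum>i\<in>I. f i t)"
    using insert.prems by (intro choquet_add borel_measurable_sum sum_nonneg) auto
  also have "\<dots> \<le> choquet_integral \<nu> (f i) + (\<Sum>i\<in>I. choquet_integral \<nu> (f i))"
    using insert.prems by (intro add_left_mono insert.IH) auto
  finally show ?case using insert.hyps by simp
qed

lemma choquet_bounded_finite:
  assumes [measurable]: "f \<in> borel_measurable unit_borel" and "\<And>t. t \<in> {0..1} \<Longrightarrow> f t \<le> c"
  shows "choquet_integral \<nu> f < \<infinity>"
proof -
  have "choquet_integral \<nu> f \<le> (\<integral>\<^sup>+\<beta>\<in>{0..c}. \<nu> {0..1} \<partial>lborel)"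
    unfolding choquet_eq_superlevel
  proof (intro nn_integral_mono)
    fix \<beta> :: real
    show "\<nu> (superlevel f \<beta>) * indicator {0..} \<beta> \<le> \<nu> {0..1} * indicator {0..c} \<beta>"
    proof (cases "\<beta> \<le> c")
      case True
      then show ?thesis
        using le_total[OF superlevel_in_unit_borel[OF assms(1), of \<beta>]] by (auto simp: indicator_def)
    next
      case False
      then have "superlevel f \<beta> = {}" using assms(2) by force
      then show ?thesis by simp
    qed
  qed
  also have "\<dots> = \<nu> {0..1} * ennreal (max 0 c)"
    by (simp add: nn_integral_cmult_indicator max_def ennreal_neg)
  also have "\<dots> < \<infinity>"
    using total_finite by (simp add: ennreal_mult_less_top)
  finally show ?thesis .
qed

text \<open>By continuity the open set of points of $(0,1)$ where $w > c$, with $c = w(1/2)/2$, is nonempty, so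
it has positive $\nu$; it lies in every superlevel set at a level in $[0,c]$.\<close>
lemma choquet_pos:
  assumes "strictly_positive_set_fun \<nu>" and "continuous_on {0..1} w"
    and "\<And>t. 0 < t \<Longrightarrow> t < 1 \<Longrightarrow> 0 < w t"
  shows "0 < choquet_integral \<nu> w"
proof -
  define c where "c = w (1/2) / 2"
  have c: "0 < c" "c < w (1/2)" using assms(3)[of "1/2"] by (auto simp: c_def)
  have w[measurable]: "w \<in> borel_measurable unit_borel"
    by (rule borel_measurable_continuous_on_restrict[OF assms(2)])
  have "continuous_on {0<..<1} w"
    by (rule continuous_on_subset[OF assms(2)]) auto
  then have "open (w -` {c<..} \<inter> {0<..<1})"
    using continuous_open_preimage[of "{0<..<1}" w "{c<..}"] by (simp add: Int_commute)
  moreover have "w -` {c<..} \<inter> {0<..<1} \<inter> {0..1} \<noteq> {}"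
    using c by (auto intro!: exI[of _ "1/2"])
  ultimately have "0 < \<nu> (w -` {c<..} \<inter> {0<..<1} \<inter> {0..1})" (is "0 < \<nu> ?A")
    using assms(1) by (simp add: strictly_positive_set_fun_def)
  also have "\<nu> ?A \<le> \<nu> (superlevel w c)"
    using \<open>open _\<close>
    by (intro mono superlevel_in_unit_borel w) (auto simp: sets_restrict_space_iff)
  finally have "0 < \<nu> (superlevel w c) * ennreal c"
    using c by (simp add: ennreal_zero_less_mult_iff)
  also have "\<dots> = (\<integral>\<^sup>+\<beta>\<in>{0..c}. \<nu> (superlevel w c) \<partial>lborel)"
    using c by (simp add: nn_integral_cmult_indicator)
  also have "\<dots> \<le> choquet_integral \<nu> w"
    unfolding choquet_eq_superlevel
    proof (intro nn_integral_mono)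
    fix \<beta> :: real
    show "\<nu> (superlevel w c) * indicator {0..c} \<beta> \<le> \<nu> (superlevel w \<beta>) * indicator {0..} \<beta>"
      by (cases "\<beta> \<in> {0..c}")
        (auto intro!: mono superlevel_in_unit_borel w)
  qed
  finally show ?thesis .
qed

end

section \<open>The Choquet integral for a measure\<close>

text \<open>The layer cake formula: both sides are the measure of the region under the graph of $f$, by Tonelli.\<close>
lemma choquet_measure:
  assumes sets: "sets \<delta> = sets unit_borel" and bdd: "bounded_set_fun (emeasure \<delta>)"
    and f: "f \<in> borel_measurable unit_borel" and f0: "\<And>t. t \<in> {0..1} \<Longrightarrow> 0 \<le> f t"
  shows "choquet_integral (emeasure \<delta>) f = (\<integral>\<^sup>+t. ennreal (f t) \<partial>\<delta>)"
proof -
  have space: "space \<delta> = {0..1}"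
    using sets_eq_imp_space_eq[OF sets] by (simp add: space_restrict_space)
  have fm[measurable]: "f \<in> borel_measurable \<delta>"
    using f measurable_cong_sets[OF sets refl] by blast
  interpret finite_measure \<delta>
    using bdd by (intro finite_measureI) (auto simp: space bounded_set_fun_def)
  interpret pair_sigma_finite lborel \<delta> ..
  have "choquet_integral (emeasure \<delta>) f
      = (\<integral>\<^sup>+\<beta>. \<integral>\<^sup>+t. indicator {0..f t} \<beta> \<partial>\<delta> \<partial>lborel)"
    unfolding choquet_eq_superlevel
  proof (intro nn_integral_cong)
    fix \<beta> :: real
    have "superlevel f \<beta> \<in> sets \<delta>"
      unfolding sets by (rule superlevel_in_unit_borel[OF f])
    then have "emeasure \<delta> (superlevel f \<beta>) * indicator {0..} \<beta>
        = (\<integral>\<^sup>+t. indicator {0..} \<beta> * indicator (superlevel f \<beta>) t \<partial>\<delta>)"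
      by (simp add: nn_integral_cmult mult.commute)
    also have "\<dots> = (\<integral>\<^sup>+t. indicator {0..f t} \<beta> \<partial>\<delta>)"
      by (intro nn_integral_cong) (auto simp: space indicator_def)
    finally show "emeasure \<delta> (superlevel f \<beta>) * indicator {0..} \<beta> = (\<integral>\<^sup>+t. indicator {0..f t} \<beta> \<partial>\<delta>)" .
  qed
  also have "\<dots> = (\<integral>\<^sup>+t. \<integral>\<^sup>+\<beta>. indicator {0..f t} \<beta> \<partial>lborel \<partial>\<delta>)"
    by (rule Fubini'[symmetric]) (simp add: indicator_def case_prod_beta, measurable)
  also have "\<dots> = (\<integral>\<^sup>+t. ennreal (f t) \<partial>\<delta>)"
    using f0 by (intro nn_integral_cong) (simp add: space)
  finally show ?thesis .
qed

lemma unit_capacity_measure: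
  assumes "sets \<delta> = sets unit_borel" "bounded_set_fun (emeasure \<delta>)"
  shows "unit_capacity (emeasure \<delta>)"
proof
  show "monotone_set_fun (emeasure \<delta>)"
    using assms(1) by (auto simp: monotone_set_fun_def intro!: emeasure_mono)
  show "submodular_set_fun (emeasure \<delta>)"
    unfolding submodular_set_fun_def
    by (metis assms(1) emeasure_Un_Int order_refl)
qed (use assms in auto)

context unit_capacity
begin

lemma continuous_in_L1_plus:
  assumes "continuous_on {0..1} f" "\<And>t. t \<in> {0..1} \<Longrightarrow> 0 \<le> f t"
  shows "f \<in> L1_plus \<nu>"
proof -
  have [measurable]: "f \<in> borel_measurable unit_borel"
    by (rule borel_measurable_continuous_on_restrict[OF assms(1)])
  have "bounded (f ` {0..1})"
    by (intro compact_imp_bounded compact_continuous_image assms(1)) simp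
  then obtain c where c: "\<forall>y\<in>f ` {0..1}. norm y \<le> c"
    unfolding bounded_iff by blast
  have "choquet_integral \<nu> (\<lambda>t. \<bar>f t\<bar>) < \<infinity>"
    using c by (intro choquet_bounded_finite[of _ c]) auto
  then show ?thesis
    using assms(2) by (simp add: L1_plus_def L1_space_def L1_norm_def)
qed

end

lemma L1_norm_nonneg:
  assumes "\<And>t. t \<in> {0..1} \<Longrightarrow> 0 \<le> f t"
  shows "L1_norm \<nu> f = choquet_integral \<nu> f"
  unfolding L1_norm_def by (intro choquet_cong) (simp add: assms)

lemma L1_plusD:
  assumes "f \<in> L1_plus \<nu>"
  shows "f \<in> borel_measurable unit_borel" "\<And>t. t \<in> {0..1} \<Longrightarrow> 0 \<le> f t"
    "choquet_integral \<nu> f < \<infinity>"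
  using assms L1_norm_nonneg[of f \<nu>] by (auto simp: L1_plus_def L1_space_def)

section \<open>Weighted Choquet means\<close>

text \<open>One notion for all the coefficients of the operator: those with $k < n$ are the case in which the set
function is the measure $\delta$.\<close>
definition choquet_mean :: "(real set \<Rightarrow> ennreal) \<Rightarrow> (real \<Rightarrow> real) \<Rightarrow> (real \<Rightarrow> real) \<Rightarrow> real" where
  "choquet_mean \<nu> w f =
     enn2real (choquet_integral \<nu> (\<lambda>t. f t * w t)) / enn2real (choquet_integral \<nu> w)"

lemma choquet_mean_nonneg: "0 \<le> choquet_mean \<nu> w f"
  by (simp add: choquet_mean_def)

locale weighted_capacity = unit_capacity +
  fixes w :: "real \<Rightarrow> real"
  assumes strictly_positive: "strictly_positive_set_fun \<nu>"
    and weight_continuous: "continuous_on {0..1} w"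
    and weight_nonneg: "\<And>t. t \<in> {0..1} \<Longrightarrow> 0 \<le> w t"
    and weight_le_1: "\<And>t. t \<in> {0..1} \<Longrightarrow> w t \<le> 1"
    and weight_pos: "\<And>t. 0 < t \<Longrightarrow> t < 1 \<Longrightarrow> 0 < w t"
begin

lemma weight_measurable [measurable]: "w \<in> borel_measurable unit_borel"
  by (rule borel_measurable_continuous_on_restrict[OF weight_continuous])

lemma weighted_finite:
  assumes "f \<in> L1_plus \<nu>"
  shows "choquet_integral \<nu> (\<lambda>t. f t * w t) < \<infinity>"
proof -
  note [measurable] = L1_plusD(1)[OF assms]
  have "choquet_integral \<nu> (\<lambda>t. f t * w t) \<le> choquet_integral \<nu> f"
    using L1_plusD(2)[OF assms] weight_le_1
    by (intro choquet_mono) (auto intro: mult_left_le)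
  then show ?thesis
    using L1_plusD(3)[OF assms] by order
qed

lemma total_weight_finite: "choquet_integral \<nu> w < \<infinity>"
  using weight_le_1 by (intro choquet_bounded_finite[of _ 1]) auto

lemma total_weight_pos: "0 < enn2real (choquet_integral \<nu> w)"
  using choquet_pos[OF strictly_positive weight_continuous weight_pos] total_weight_finite
  by (simp add: enn2real_positive_iff)

lemma mean_times_weight:
  assumes "f \<in> L1_plus \<nu>"
  shows "ennreal (choquet_mean \<nu> w f) * choquet_integral \<nu> w = choquet_integral \<nu> (\<lambda>t. f t * w t)"
proof -
  have "ennreal (choquet_mean \<nu> w f) * ennreal (enn2real (choquet_integral \<nu> w))
      = ennreal (enn2real (choquet_integral \<nu> (\<lambda>t. f t * w t)))"
    using total_weight_pos
    by (subst ennreal_mult'[symmetric]) (auto simp: choquet_mean_nonneg, simp add: choquet_mean_def)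
  then show ?thesis
    using weighted_finite[OF assms] total_weight_finite by simp
qed

text \<open>Monotonicity, subadditivity and positive homogeneity of the mean, in the combined form in which the
error estimates use them.\<close>
lemma mean_le:
  assumes L1: "f \<in> L1_plus \<nu>" "g \<in> L1_plus \<nu>" "h \<in> L1_plus \<nu>" and c: "0 \<le> c"
    and le: "\<And>t. t \<in> {0..1} \<Longrightarrow> f t \<le> g t + c * h t"
  shows "choquet_mean \<nu> w f \<le> choquet_mean \<nu> w g + c * choquet_mean \<nu> w h"
proof -
  note [measurable] = L1_plusD(1)[OF L1(1)] L1_plusD(1)[OF L1(2)] L1_plusD(1)[OF L1(3)]
  let ?C = "\<lambda>f. choquet_integral \<nu> (\<lambda>t. f t * w t)"
  have "?C f \<le> choquet_integral \<nu> (\<lambda>t. g t * w t + c * (h t * w t))"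
  proof (rule choquet_mono)
    fix t :: real assume t: "t \<in> {0..1}"
    show "f t * w t \<le> g t * w t + c * (h t * w t)"
      using mult_right_mono[OF le[OF t] weight_nonneg[OF t]] by (simp add: algebra_simps)
  qed measurable
  also have "\<dots> \<le> ?C g + choquet_integral \<nu> (\<lambda>t. c * (h t * w t))"
    using L1_plusD(2)[OF L1(2)] L1_plusD(2)[OF L1(3)] weight_nonneg c
    by (intro choquet_add) auto
  also have "\<dots> = ?C g + ennreal c * ?C h"
    using c by (subst choquet_cmult) auto
  finally have le: "?C f \<le> ?C g + ennreal c * ?C h" .
  have "enn2real (?C f) \<le> enn2real (?C g + ennreal c * ?C h)"
    using weighted_finite[OF L1(2)] weighted_finite[OF L1(3)]
    by (intro enn2real_mono le) (auto simp: ennreal_mult_less_top)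
  also have "\<dots> = enn2real (?C g) + c * enn2real (?C h)"
    using weighted_finite[OF L1(2)] weighted_finite[OF L1(3)] c
    by (subst enn2real_plus) (auto simp: ennreal_mult_less_top enn2real_mult)
  finally show ?thesis
    using total_weight_pos unfolding choquet_mean_def
    by (simp add: field_simps)
qed

lemma mean_const: "0 \<le> c \<Longrightarrow> choquet_mean \<nu> w (\<lambda>t. c) = c"
  using choquet_cmult[of w c] total_weight_pos
  by (simp add: choquet_mean_def enn2real_mult)

text \<open>This makes $x \mapsto D(\varphi_x)(x)$ continuous, hence Borel, which has to be known before its Choquet
integral can be compared with another: a monotone set function compares Borel sets only.\<close>
lemma mean_distance_lipschitz:
  "\<bar>choquet_mean \<nu> w (\<lambda>t. \<bar>t - x\<bar>) - choquet_mean \<nu> w (\<lambda>t. \<bar>t - y\<bar>)\<bar> \<le> \<bar>x - y\<bar>"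
proof -
  have "choquet_mean \<nu> w (\<lambda>t. \<bar>t - x\<bar>) \<le> choquet_mean \<nu> w (\<lambda>t. \<bar>t - y\<bar>) + \<bar>x - y\<bar> * choquet_mean \<nu> w (\<lambda>t. 1)" for x y
    by (intro mean_le continuous_in_L1_plus continuous_intros) auto
  from this[of x y] this[of y x] show ?thesis
    by (simp add: mean_const abs_le_iff abs_minus_commute)
qed

end

section \<open>The Bernstein-Durrmeyer-Choquet operator\<close>

lemma Bernstein_le_1:
  assumes "t \<in> {0..1}" "k \<le> n"
  shows "Bernstein n k t \<le> 1"
proof -
  have "Bernstein n k t \<le> (\<Sum>k\<le>n. Bernstein n k t)"
    using assms by (intro member_le_sum) (auto intro: Bernstein_nonneg)
  then show ?thesis by simp
qed

lemma continuous_on_Bernstein: "continuous_on A (Bernstein n k)"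
  unfolding Bernstein_def[abs_def] by (intro continuous_intros)

lemma Bernstein_measurable [measurable]: "Bernstein n k \<in> borel_measurable unit_borel"
  by (intro borel_measurable_continuous_on_restrict continuous_on_Bernstein)

lemma Bernstein_self: "Bernstein n n x = x ^ n"
  by (simp add: Bernstein_def)

lemma weighted_capacity_Bernstein:
  assumes "unit_capacity \<nu>" "strictly_positive_set_fun \<nu>" "k \<le> n"
  shows "weighted_capacity \<nu> (Bernstein n k)"
proof -
  interpret unit_capacity \<nu> by fact
  show ?thesis
    using assms(2,3)
    by unfold_locales (auto intro: Bernstein_nonneg Bernstein_le_1 Bernstein_pos continuous_on_Bernstein)
qed

locale capacity_below_measure = unit_capacity \<mu>
  for \<mu> :: "real set \<Rightarrow> ennreal" +
  fixes \<delta> :: "real measure"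
  assumes pos_\<mu>: "strictly_positive_set_fun \<mu>"
    and sets_\<delta>: "sets \<delta> = sets unit_borel"
    and bdd_\<delta>: "bounded_set_fun (emeasure \<delta>)"
    and pos_\<delta>: "strictly_positive_set_fun (emeasure \<delta>)"
    and le_\<delta>: "\<And>A. A \<in> sets unit_borel \<Longrightarrow> \<mu> A \<le> emeasure \<delta> A"
begin

sublocale \<delta>: unit_capacity "emeasure \<delta>"
  by (rule unit_capacity_measure[OF sets_\<delta> bdd_\<delta>])

lemma space_\<delta>: "space \<delta> = {0..1}"
  using sets_eq_imp_space_eq[OF sets_\<delta>] by (simp add: space_restrict_space)

lemma measurable_\<delta>: "f \<in> borel_measurable \<delta> \<longleftrightarrow> f \<in> borel_measurable unit_borel"
  using measurable_cong_sets[OF sets_\<delta> refl] by blast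

lemma L1_plus_subset: "L1_plus (emeasure \<delta>) \<subseteq> L1_plus \<mu>"
proof
  fix f assume f: "f \<in> L1_plus (emeasure \<delta>)"
  have "choquet_integral \<mu> f \<le> choquet_integral (emeasure \<delta>) f"
    by (rule choquet_set_fun_mono[OF le_\<delta> L1_plusD(1)[OF f]])
  then have "choquet_integral \<mu> f < \<infinity>"
    using L1_plusD(3)[OF f] by order
  then show "f \<in> L1_plus \<mu>"
    using L1_plusD[OF f] L1_norm_nonneg[of f \<mu>] by (auto simp: L1_plus_def L1_space_def)
qed

definition coefficient_capacity :: "nat \<Rightarrow> nat \<Rightarrow> real set \<Rightarrow> ennreal" where
  "coefficient_capacity n k = (if k < n then emeasure \<delta> else \<mu>)"

abbreviation coefficient :: "nat \<Rightarrow> nat \<Rightarrow> (real \<Rightarrow> real) \<Rightarrow> real" where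
  "coefficient n k \<equiv> choquet_mean (coefficient_capacity n k) (Bernstein n k)"

lemma coefficient_weighted: "k \<le> n \<Longrightarrow> weighted_capacity (coefficient_capacity n k) (Bernstein n k)"
  unfolding coefficient_capacity_def
  using weighted_capacity_Bernstein[OF unit_capacity_axioms pos_\<mu>]
    weighted_capacity_Bernstein[OF \<delta>.unit_capacity_axioms pos_\<delta>] by simp

lemma L1_plus_coefficient: "f \<in> L1_plus (emeasure \<delta>) \<Longrightarrow> f \<in> L1_plus (coefficient_capacity n k)"
  using L1_plus_subset by (auto simp: coefficient_capacity_def)

lemma lebesgue_eq_choquet:
  assumes "f \<in> borel_measurable unit_borel" "\<And>t. t \<in> {0..1} \<Longrightarrow> 0 \<le> f t"
  shows "(LINT t|\<delta>. f t) = enn2real (choquet_integral (emeasure \<delta>) f)"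
proof -
  have "f \<in> borel_measurable \<delta>" "AE t in \<delta>. 0 \<le> f t"
    using assms by (auto simp: measurable_\<delta> space_\<delta>)
  then show ?thesis
    by (simp only: integral_eq_nn_integral choquet_measure[OF sets_\<delta> bdd_\<delta> assms])
qed

lemma BDC_eq_coefficients:
  assumes f: "f \<in> L1_plus (emeasure \<delta>)"
  shows "BDC_operator \<mu> \<delta> n f x = (\<Sum>k\<le>n. Bernstein n k x * coefficient n k f)"
proof -
  note [measurable] = L1_plusD(1)[OF f]
  have "(LINT t|\<delta>. f t * Bernstein n k t) / (LINT t|\<delta>. Bernstein n k t) = coefficient n k f"
    if "k < n" for k
  proof -
    have "(LINT t|\<delta>. f t * Bernstein n k t) = enn2real (choquet_integral (emeasure \<delta>) (\<lambda>t. f t * Bernstein n k t))"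
      by (intro lebesgue_eq_choquet) (auto intro!: mult_nonneg_nonneg Bernstein_nonneg L1_plusD(2)[OF f])
    moreover have "(LINT t|\<delta>. Bernstein n k t) = enn2real (choquet_integral (emeasure \<delta>) (Bernstein n k))"
      by (intro lebesgue_eq_choquet) (auto intro: Bernstein_nonneg)
    ultimately show ?thesis
      using that by (simp add: choquet_mean_def coefficient_capacity_def)
  qed
  moreover have "enn2real (choquet_integral \<mu> (\<lambda>t. f t * t ^ n)) / enn2real (choquet_integral \<mu> (\<lambda>t. t ^ n))
      = coefficient n n f"
    unfolding choquet_mean_def Bernstein_self[symmetric] by (simp add: coefficient_capacity_def)
  ultimately show ?thesis
    unfolding BDC_operator_def
    by (simp add: lessThan_Suc_atMost[symmetric] Bernstein_self)
qed

lemma BDC_le: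
  assumes L1: "f \<in> L1_plus (emeasure \<delta>)" "g \<in> L1_plus (emeasure \<delta>)" "h \<in> L1_plus (emeasure \<delta>)"
    and c: "0 \<le> c" and le: "\<And>t. t \<in> {0..1} \<Longrightarrow> f t \<le> g t + c * h t" and x: "x \<in> {0..1}"
  shows "BDC_operator \<mu> \<delta> n f x \<le> BDC_operator \<mu> \<delta> n g x + c * BDC_operator \<mu> \<delta> n h x"
proof -
  have "Bernstein n k x * coefficient n k f
      \<le> Bernstein n k x * (coefficient n k g + c * coefficient n k h)" if "k \<le> n" for k
    using L1 c le x
    by (intro mult_left_mono weighted_capacity.mean_le[OF coefficient_weighted[OF that]]
        L1_plus_coefficient) (auto intro: Bernstein_nonneg)
  then have "(\<Sum>k\<le>n. Bernstein n k x * coefficient n k f)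
      \<le> (\<Sum>k\<le>n. Bernstein n k x * (coefficient n k g + c * coefficient n k h))"
    by (intro sum_mono) simp
  then show ?thesis
    unfolding BDC_eq_coefficients[OF L1(1)] BDC_eq_coefficients[OF L1(2)] BDC_eq_coefficients[OF L1(3)]
    by (simp add: algebra_simps sum.distrib sum_distrib_left)
qed

lemma BDC_const:
  assumes "0 \<le> c"
  shows "BDC_operator \<mu> \<delta> n (\<lambda>t. c) x = c"
proof -
  have "(\<lambda>t. c) \<in> L1_plus (emeasure \<delta>)"
    using assms by (intro \<delta>.continuous_in_L1_plus continuous_intros)
  then have "BDC_operator \<mu> \<delta> n (\<lambda>t. c) x = (\<Sum>k\<le>n. Bernstein n k x * coefficient n k (\<lambda>t. c))"
    by (rule BDC_eq_coefficients)
  also have "\<dots> = (\<Sum>k\<le>n. Bernstein n k x * c)"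
    using assms by (intro sum.cong) (simp_all add: weighted_capacity.mean_const[OF coefficient_weighted])
  also have "\<dots> = c"
    by (simp add: sum_distrib_right[symmetric])
  finally show ?thesis .
qed

lemma BDC_nonneg:
  assumes "f \<in> L1_plus (emeasure \<delta>)" "x \<in> {0..1}"
  shows "0 \<le> BDC_operator \<mu> \<delta> n f x"
  unfolding BDC_eq_coefficients[OF assms(1)] using assms(2)
  by (intro sum_nonneg mult_nonneg_nonneg choquet_mean_nonneg Bernstein_nonneg) auto

lemma BDC_measurable:
  assumes "f \<in> L1_plus (emeasure \<delta>)"
  shows "BDC_operator \<mu> \<delta> n f \<in> borel_measurable unit_borel"
proof -
  have "continuous_on {0..1} (\<lambda>x. \<Sum>k\<le>n. Bernstein n k x * coefficient n k f)"
    by (intro continuous_on_sum continuous_on_mult continuous_on_const continuous_on_Bernstein)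
  then have "continuous_on {0..1} (BDC_operator \<mu> \<delta> n f)"
    by (simp only: BDC_eq_coefficients[OF assms] cong: continuous_on_cong)
  then show ?thesis
    by (rule borel_measurable_continuous_on_restrict)
qed

lemma distance_in_L1_plus: "(\<lambda>t. \<bar>t - x\<bar>) \<in> L1_plus (emeasure \<delta>)"
  by (intro \<delta>.continuous_in_L1_plus continuous_intros) auto

lemma BDC_distance_measurable:
  "(\<lambda>x. BDC_operator \<mu> \<delta> n (\<lambda>t. \<bar>t - x\<bar>) x) \<in> borel_measurable unit_borel"
proof -
  have "continuous_on {0..1} (\<lambda>x. coefficient n k (\<lambda>t. \<bar>t - x\<bar>))" if "k \<le> n" for k
  proof -
    have "1-lipschitz_on {0..1} (\<lambda>x. coefficient n k (\<lambda>t. \<bar>t - x\<bar>))"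
      using weighted_capacity.mean_distance_lipschitz[OF coefficient_weighted[OF that]]
      by (intro lipschitz_onI) (auto simp: dist_real_def)
    then show ?thesis by (rule lipschitz_on_continuous_on)
  qed
  then show ?thesis
    unfolding BDC_eq_coefficients[OF distance_in_L1_plus]
    by (intro borel_measurable_continuous_on_restrict continuous_on_sum continuous_on_mult
        continuous_on_Bernstein) auto
qed

text \<open>For $k < n$ the bound $\mu \le \delta$ allows $\int p_{n,k}\,d\delta$, the denominator of the coefficient,
to replace $(C)\int p_{n,k}\,d\mu$, so that the $k$-th term contributes at most $\int h\, p_{n,k}\,d\delta$;
these are additive in $k$ and $\sum_{k<n} p_{n,k} \le 1$. For $k = n$ the denominator is the $\mu$-integral
itself and the contribution is $(C)\int h(t) t^n\,d\mu(t)$.\<close>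
lemma BDC_norm_le:
  assumes h: "h \<in> L1_plus (emeasure \<delta>)"
  shows "choquet_integral \<mu> (BDC_operator \<mu> \<delta> n h)
    \<le> choquet_integral \<mu> h + choquet_integral (emeasure \<delta>) h"
proof -
  note [measurable] = L1_plusD(1)[OF h]
  note h0 = L1_plusD(2)[OF h]
  have term_le: "choquet_integral \<mu> (\<lambda>x. Bernstein n k x * coefficient n k h)
      \<le> choquet_integral (coefficient_capacity n k) (\<lambda>t. h t * Bernstein n k t)" if "k \<le> n" for k
  proof -
    have "choquet_integral \<mu> (\<lambda>x. Bernstein n k x * coefficient n k h)
        = ennreal (coefficient n k h) * choquet_integral \<mu> (Bernstein n k)"
      unfolding mult.commute[of "Bernstein n k _" "coefficient n k h"]
      by (rule choquet_cmult[OF Bernstein_measurable choquet_mean_nonneg])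
    also have "\<dots> \<le> ennreal (coefficient n k h) * choquet_integral (coefficient_capacity n k) (Bernstein n k)"
      using choquet_set_fun_mono[OF le_\<delta> Bernstein_measurable]
      by (intro mult_left_mono) (auto simp: coefficient_capacity_def)
    also have "\<dots> = choquet_integral (coefficient_capacity n k) (\<lambda>t. h t * Bernstein n k t)"
      by (rule weighted_capacity.mean_times_weight[OF coefficient_weighted[OF that] L1_plus_coefficient[OF h]])
    finally show ?thesis .
  qed
  have last: "choquet_integral \<mu> (\<lambda>t. h t * Bernstein n n t) \<le> choquet_integral \<mu> h"
    by (intro choquet_mono) (auto intro!: mult_left_le h0 Bernstein_le_1)
  have "(\<Sum>k<n. choquet_integral (emeasure \<delta>) (\<lambda>t. h t * Bernstein n k t))
      = (\<Sum>k<n. \<integral>\<^sup>+t. ennreal (h t * Bernstein n k t) \<partial>\<delta>)"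
    by (intro sum.cong refl choquet_measure sets_\<delta> bdd_\<delta>) (auto simp: h0 Bernstein_nonneg)
  also have "\<dots> = (\<integral>\<^sup>+t. (\<Sum>k<n. ennreal (h t * Bernstein n k t)) \<partial>\<delta>)"
    by (intro nn_integral_sum[symmetric]) (simp add: measurable_\<delta>)
  also have "\<dots> \<le> (\<integral>\<^sup>+t. ennreal (h t) \<partial>\<delta>)"
  proof (intro nn_integral_mono)
    fix t assume "t \<in> space \<delta>"
    then have t: "t \<in> {0..1}" by (simp add: space_\<delta>)
    have "(\<Sum>k<n. ennreal (h t * Bernstein n k t)) = ennreal (h t * (\<Sum>k<n. Bernstein n k t))"
      using t h0[OF t] by (subst sum_ennreal) (auto simp: Bernstein_nonneg sum_distrib_left)
    also have "(\<Sum>k<n. Bernstein n k t) \<le> (\<Sum>k\<le>n. Bernstein n k t)"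
      using t by (intro sum_mono2) (auto simp: Bernstein_nonneg)
    then have "ennreal (h t * (\<Sum>k<n. Bernstein n k t)) \<le> ennreal (h t)"
      using h0[OF t] by (intro ennreal_leI mult_left_le) auto
    finally show "(\<Sum>k<n. ennreal (h t * Bernstein n k t)) \<le> ennreal (h t)" .
  qed
  also have "\<dots> = choquet_integral (emeasure \<delta>) h"
    by (rule choquet_measure[symmetric, OF sets_\<delta> bdd_\<delta>]) (auto simp: h0)
  finally have first: "(\<Sum>k<n. choquet_integral (emeasure \<delta>) (\<lambda>t. h t * Bernstein n k t))
      \<le> choquet_integral (emeasure \<delta>) h" .
  have "choquet_integral \<mu> (BDC_operator \<mu> \<delta> n h)
      = choquet_integral \<mu> (\<lambda>x. \<Sum>k\<le>n. Bernstein n k x * coefficient n k h)"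
    by (intro choquet_cong BDC_eq_coefficients[OF h])
  also have "\<dots> \<le> (\<Sum>k\<le>n. choquet_integral \<mu> (\<lambda>x. Bernstein n k x * coefficient n k h))"
    by (intro choquet_sum) (auto intro!: mult_nonneg_nonneg choquet_mean_nonneg Bernstein_nonneg)
  also have "\<dots> \<le> (\<Sum>k\<le>n. choquet_integral (coefficient_capacity n k) (\<lambda>t. h t * Bernstein n k t))"
    by (intro sum_mono term_le) simp
  also have "\<dots> = (\<Sum>k<n. choquet_integral (emeasure \<delta>) (\<lambda>t. h t * Bernstein n k t))
      + choquet_integral \<mu> (\<lambda>t. h t * Bernstein n n t)"
    by (simp add: lessThan_Suc_atMost[symmetric] coefficient_capacity_def)
  also have "\<dots> \<le> choquet_integral (emeasure \<delta>) h + choquet_integral \<mu> h"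
    by (intro add_mono first last)
  finally show ?thesis by (simp add: add.commute)
qed

end

section \<open>The error estimate\<close>

lemma C1_plus_lipschitz:
  assumes "g \<in> C1_plus"
  obtains M where "0 \<le> M" "sup_norm (unit_deriv g) = ennreal M"
    "\<And>s t. s \<in> {0..1} \<Longrightarrow> t \<in> {0..1} \<Longrightarrow> \<bar>g s - g t\<bar> \<le> M * \<bar>s - t\<bar>"
proof -
  have diff: "g differentiable_on {0..1}" and cont: "continuous_on {0..1} (unit_deriv g)"
    using assms by (auto simp: C1_plus_def)
  have "compact ((\<lambda>x. \<bar>unit_deriv g x\<bar>) ` {0..1})"
    by (intro compact_continuous_image continuous_intros cont) simp
  then obtain y where y: "y \<in> {0..1}" "\<And>x. x \<in> {0..1} \<Longrightarrow> \<bar>unit_deriv g x\<bar> \<le> \<bar>unit_deriv g y\<bar>"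
    using compact_attains_sup[of "(\<lambda>x. \<bar>unit_deriv g x\<bar>) ` {0..1}"] by auto
  show ?thesis
  proof
    show "0 \<le> \<bar>unit_deriv g y\<bar>" by simp
    show "sup_norm (unit_deriv g) = ennreal \<bar>unit_deriv g y\<bar>"
      unfolding sup_norm_def using y
      by (intro antisym SUP_least SUP_upper2[of y] ennreal_leI) auto
    fix s t :: real assume st: "s \<in> {0..1}" "t \<in> {0..1}"
    have der: "(g has_derivative (\<lambda>h. h *\<^sub>R unit_deriv g x)) (at x within {0..1})"
      if "x \<in> {0..1}" for x
      using diff that vector_derivative_works[of g "at x within {0..1}"]
      by (simp add: differentiable_on_def has_vector_derivative_def unit_deriv_def)
    have "norm (g s - g t) \<le> \<bar>unit_deriv g y\<bar> * norm (s - t)"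
    proof (rule differentiable_bound[OF _ der _ st(1) st(2)])
      fix x :: real assume x: "x \<in> {0..1}"
      show "onorm (\<lambda>h. h *\<^sub>R unit_deriv g x) \<le> \<bar>unit_deriv g y\<bar>"
      proof (rule onorm_bound)
        show "norm (h *\<^sub>R unit_deriv g x) \<le> \<bar>unit_deriv g y\<bar> * norm h" for h :: real
          using mult_right_mono[OF y(2)[OF x], of "\<bar>h\<bar>"] by (simp add: abs_mult mult.commute)
      qed simp
    qed auto
    then show "\<bar>g s - g t\<bar> \<le> \<bar>unit_deriv g y\<bar> * \<bar>s - t\<bar>" by simp
  qed
qed

text \<open>With $x$ fixed, $g(x)$ is a constant function of $t$ and is reproduced by the operator; applying the
operator to $g(t) \le g(x) + M |t - x|$ and to $g(x) \le g(t) + M |t - x|$ bounds both signs of the error.\<close>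
lemma (in capacity_below_measure) BDC_smooth_error:
  assumes g: "g \<in> L1_plus (emeasure \<delta>)" and M: "0 \<le> M"
    and lip: "\<And>s t. s \<in> {0..1} \<Longrightarrow> t \<in> {0..1} \<Longrightarrow> \<bar>g s - g t\<bar> \<le> M * \<bar>s - t\<bar>"
    and x: "x \<in> {0..1}"
  shows "\<bar>g x - BDC_operator \<mu> \<delta> n g x\<bar> \<le> M * BDC_operator \<mu> \<delta> n (\<lambda>t. \<bar>t - x\<bar>) x"
proof -
  have gx: "0 \<le> g x" using L1_plusD(2)[OF g x] .
  then have const: "(\<lambda>t. g x) \<in> L1_plus (emeasure \<delta>)"
    by (intro \<delta>.continuous_in_L1_plus continuous_intros)
  have "g t \<le> g x + M * \<bar>t - x\<bar>" and "g x \<le> g t + M * \<bar>t - x\<bar>" if "t \<in> {0..1}" for t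
    using lip[OF that x] by (auto simp: abs_le_iff)
  then have "BDC_operator \<mu> \<delta> n g x \<le> BDC_operator \<mu> \<delta> n (\<lambda>t. g x) x + M * BDC_operator \<mu> \<delta> n (\<lambda>t. \<bar>t - x\<bar>) x"
    and "BDC_operator \<mu> \<delta> n (\<lambda>t. g x) x \<le> BDC_operator \<mu> \<delta> n g x + M * BDC_operator \<mu> \<delta> n (\<lambda>t. \<bar>t - x\<bar>) x"
    by (intro BDC_le g const distance_in_L1_plus M x; simp)+
  then show ?thesis
    by (simp add: BDC_const[OF gx] abs_le_iff)
qed

lemma ennreal_twice_half: "2 * (x / 2) = (x :: ennreal)"
  by (simp add: ennreal_times_divide mult.commute[of 2] mult_divide_eq_ennreal)

text \<open>The function $|f - g|$ is integrated twice against $\mu$, once directly and once through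
$D |f - g|$; this is where the factor 2 comes from, and the second argument of the K-functional is
halved to compensate it in the term with $M$.\<close>
lemma (in capacity_below_measure) BDC_error_le:
  assumes f: "f \<in> L1_plus (emeasure \<delta>)" and g: "g \<in> C1_plus"
  shows "L1_norm \<mu> (\<lambda>x. f x - BDC_operator \<mu> \<delta> n f x)
    \<le> 2 * (L1_norm \<mu> (\<lambda>x. f x - g x) + L1_norm (emeasure \<delta>) (\<lambda>x. f x - g x)
        + L1_norm \<mu> (\<lambda>x. BDC_operator \<mu> \<delta> n (\<lambda>t. \<bar>t - x\<bar>) x) / 2 * sup_norm (unit_deriv g))"
proof -
  obtain M where M: "0 \<le> M" "sup_norm (unit_deriv g) = ennreal M"
    and lip: "\<And>s t. s \<in> {0..1} \<Longrightarrow> t \<in> {0..1} \<Longrightarrow> \<bar>g s - g t\<bar> \<le> M * \<bar>s - t\<bar>"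
    using C1_plus_lipschitz[OF g] by metis
  have gL: "g \<in> L1_plus (emeasure \<delta>)"
    using g by (intro \<delta>.continuous_in_L1_plus) (auto simp: C1_plus_def differentiable_imp_continuous_on)
  note [measurable] = L1_plusD(1)[OF f] L1_plusD(1)[OF gL]
  let ?D = "BDC_operator \<mu> \<delta> n"
  define h where "h = (\<lambda>t. \<bar>f t - g t\<bar>)"
  define e where "e = (\<lambda>x. ?D (\<lambda>t. \<bar>t - x\<bar>) x)"
  have [measurable]: "h \<in> borel_measurable unit_borel" by (simp add: h_def)
  have e_meas[measurable]: "e \<in> borel_measurable unit_borel"
    unfolding e_def by (rule BDC_distance_measurable)
  have h0: "0 \<le> h x" for x by (simp add: h_def)
  have e0: "0 \<le> e x" if "x \<in> {0..1}" for x
    unfolding e_def by (rule BDC_nonneg[OF distance_in_L1_plus that])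
  have norm_e: "L1_norm \<mu> (\<lambda>x. ?D (\<lambda>t. \<bar>t - x\<bar>) x) = choquet_integral \<mu> e"
    using L1_norm_nonneg[OF e0] by (simp add: e_def)
  have norm_diff: "L1_norm \<nu> (\<lambda>x. f x - g x) = choquet_integral \<nu> h" for \<nu>
    by (simp add: L1_norm_def h_def)
  have hL: "h \<in> L1_plus (emeasure \<delta>)"
  proof -
    have "choquet_integral (emeasure \<delta>) h \<le> choquet_integral (emeasure \<delta>) (\<lambda>t. f t + g t)"
      using L1_plusD(2)[OF f] L1_plusD(2)[OF gL]
      by (intro \<delta>.choquet_mono) (force simp: h_def abs_le_iff)+
    also have "\<dots> \<le> choquet_integral (emeasure \<delta>) f + choquet_integral (emeasure \<delta>) g"
      using L1_plusD(2)[OF f] L1_plusD(2)[OF gL] by (intro \<delta>.choquet_add) auto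
    also have "\<dots> < \<infinity>"
      using L1_plusD(3)[OF f] L1_plusD(3)[OF gL] by simp
    finally show ?thesis
      by (simp add: L1_plus_def L1_space_def L1_norm_def) (simp add: h_def)
  qed
  note [measurable] = BDC_measurable[OF f] BDC_measurable[OF hL]
  have pointwise: "\<bar>f x - ?D f x\<bar> \<le> h x + (M * e x + ?D h x)" if x: "x \<in> {0..1}" for x
  proof -
    have "?D f x \<le> ?D g x + 1 * ?D h x"
      by (intro BDC_le f gL hL x) (auto simp: h_def)
    moreover have "?D g x \<le> ?D f x + 1 * ?D h x"
      by (intro BDC_le f gL hL x) (auto simp: h_def)
    moreover have "\<bar>g x - ?D g x\<bar> \<le> M * e x"
      unfolding e_def by (rule BDC_smooth_error[OF gL M(1) lip x])
    ultimately show ?thesis by (simp add: h_def abs_le_iff) linarith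
  qed
  have "L1_norm \<mu> (\<lambda>x. f x - ?D f x) \<le> choquet_integral \<mu> (\<lambda>x. h x + (M * e x + ?D h x))"
    unfolding L1_norm_def by (intro choquet_mono pointwise) measurable
  also have "\<dots> \<le> choquet_integral \<mu> h + choquet_integral \<mu> (\<lambda>x. M * e x + ?D h x)"
    using M(1) e0 h0 BDC_nonneg[OF hL] by (intro choquet_add) auto
  also have "\<dots> \<le> choquet_integral \<mu> h + (choquet_integral \<mu> (\<lambda>x. M * e x) + choquet_integral \<mu> (?D h))"
    using M(1) e0 BDC_nonneg[OF hL] by (intro add_left_mono choquet_add) auto
  also have "\<dots> \<le> choquet_integral \<mu> h + (ennreal M * choquet_integral \<mu> e
      + (choquet_integral \<mu> h + choquet_integral (emeasure \<delta>) h))"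
    by (intro add_left_mono add_mono BDC_norm_le[OF hL]) (simp add: choquet_cmult M(1))
  also have "\<dots> \<le> 2 * (choquet_integral \<mu> h + choquet_integral (emeasure \<delta>) h)
      + 2 * (choquet_integral \<mu> e / 2) * ennreal M"
  proof -
    have "choquet_integral \<mu> h + (ennreal M * choquet_integral \<mu> e
        + (choquet_integral \<mu> h + choquet_integral (emeasure \<delta>) h))
      = (2 * choquet_integral \<mu> h + choquet_integral (emeasure \<delta>) h) + choquet_integral \<mu> e * ennreal M"
      unfolding mult_2 by (simp only: ac_simps)
    also have "\<dots> \<le> (2 * choquet_integral \<mu> h + 2 * choquet_integral (emeasure \<delta>) h) + choquet_integral \<mu> e * ennreal M"
      by (intro add_left_mono add_right_mono) (simp add: mult_2)
    finally show ?thesis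
      by (simp only: distrib_left ennreal_twice_half)
  qed
  also have "\<dots> = 2 * (choquet_integral \<mu> h + choquet_integral (emeasure \<delta>) h
      + choquet_integral \<mu> e / 2 * ennreal M)"
    by (simp only: distrib_left mult.assoc)
  finally show ?thesis
    by (simp only: norm_e norm_diff M(2))
qed

theorem theorem3p3:
  fixes \<mu> :: "real set \<Rightarrow> ennreal" and \<delta> :: "real measure"
  assumes "bounded_set_fun \<mu>" and "monotone_set_fun \<mu>"
    and "submodular_set_fun \<mu>" and "strictly_positive_set_fun \<mu>"
    and "sets \<delta> = sets unit_borel"
    and "bounded_set_fun (emeasure \<delta>)" and "strictly_positive_set_fun (emeasure \<delta>)"
    and "\<And>A. A \<in> sets unit_borel \<Longrightarrow> \<mu> A \<le> emeasure \<delta> A"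
  shows "L1_plus (emeasure \<delta>) \<subseteq> L1_plus \<mu> \<and>
    (\<forall>f\<in>L1_plus (emeasure \<delta>). \<forall>n::nat.
       L1_norm \<mu> (\<lambda>x. f x - BDC_operator \<mu> \<delta> n f x)
         \<le> 2 * K_functional \<mu> \<delta> f
               (L1_norm \<mu> (\<lambda>x. BDC_operator \<mu> \<delta> n (\<lambda>t. \<bar>t - x\<bar>) x) / 2))"
proof -
  interpret capacity_below_measure \<mu> \<delta>
    by unfold_locales fact+
  show ?thesis
  proof (intro conjI ballI allI L1_plus_subset)
    fix f and n :: nat
    assume f: "f \<in> L1_plus (emeasure \<delta>)"
    let ?E = "L1_norm \<mu> (\<lambda>x. f x - BDC_operator \<mu> \<delta> n f x)"
    let ?K = "K_functional \<mu> \<delta> f (L1_norm \<mu> (\<lambda>x. BDC_operator \<mu> \<delta> n (\<lambda>t. \<bar>t - x\<bar>) x) / 2)"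
    have "?E / 2 \<le> ?K"
      unfolding K_functional_def
      using BDC_error_le[OF f]
      by (intro INF_greatest divide_le_posI_ennreal) auto
    then show "?E \<le> 2 * ?K"
      using mult_left_mono[of "?E / 2" ?K 2] by (simp add: ennreal_twice_half)
  qed
qed

end
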